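(* Let $f_n, f:[0,1)\to\mathbb{R}$ ($n=1,2,\ldots$) be measurable functions. Suppose that $(f_n)$ converges statistically in measure to $f$, and that there exists a sequence $(\varepsilon_j)_{j\ge 1}$ of positive real numbers with $\varepsilon_j\to 0$ such that, for every $j=1,2,\ldots$, the density $d(\{n\in\mathbb{N}: |f_n(x)-f(x)|<\varepsilon_j\})$ exists for $\lambda$-almost every $x\in[0,1)$. Then for every $\varepsilon>0$, $$d(\{n\in\mathbb{N}: |f_n(x)-f(x)|\ge\varepsilon\})=0\quad\text{for }\lambda\text{-almost every }x\in[0,1),$$ that is, $(f_n)$ converges statistically almost everywhere to $f$.
   Context: $\mathbb{N}$ is the set of positive integers. The measure space is $([0,1),\Sigma,\lambda)$, with $\Sigma$ the $\sigma$-algebra of Lebesgue measurable subsets of $[0,1)$ and $\lambda$ Lebesgue measure. Density: for $A\subseteq\mathbb{N}$, $d(A)=\lim_{n\to\infty}\frac{|\{k\in A: k\le n\}|}{n}$, if this limit exists (otherwise the density of $A$ does not exist). Writing $d(A)=c$ means that the limit exists and equals $c$. Statistical convergence of real sequences: $(a_n)$ converges statistically to $a\in\mathbb{R}$ if for every $\varepsilon>0$, $d(\{n\in\mathbb{N}:|a_n-a|\ge\varepsilon\})=0$. $(f_n)$ converges statistically almost everywhere to $f$ if for $\lambda$-almost every $x\in[0,1)$ the real sequence $(f_n(x))_n$ converges statistically to $f(x)$. $(f_n)$ converges statistically in measure to $f$ if for every $\varepsilon>0$ the real sequence $\big(\lambda(\{x\in[0,1):|f_n(x)-f(x)|\ge\varepsilon\})\big)_n$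 converges statistically to $0$. *)

theory Defs
  imports "HOL-Analysis.Analysis"
begin

(* The measure space [0,1) with its Lebesgue measurable subsets and Lebesgue measure. *)
abbreviation unit_interval :: "real measure" where
  "unit_interval \<equiv> lebesgue_on {0..<1}"

(* d(A) exists and equals c.  The paper's index set is the positive integers.  Only the
   elements of A in {1..n} are counted, so whether 0 belongs to A is irrelevant; sequences
   indexed by the positive integers are represented as functions on nat whose value at 0
   plays no role. *)
definition has_density :: "nat set \<Rightarrow> real \<Rightarrow> bool" where
  "has_density A c \<longleftrightarrow> (\<lambda>n. real (card {k \<in> A. 1 \<le> k \<and> k \<le> n}) / real n) \<longlonglongrightarrow> c"

definition density_exists :: "nat set \<Rightarrow> bool" where
  "density_exists A \<longleftrightarrow> (\<exists>c. has_density A c)"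

definition stat_converges :: "(nat \<Rightarrow> real) \<Rightarrow> real \<Rightarrow> bool" where
  "stat_converges a l \<longleftrightarrow> (\<forall>\<epsilon>>0. has_density {n. \<bar>a n - l\<bar> \<ge> \<epsilon>} 0)"

definition stat_converges_AE :: "(nat \<Rightarrow> real \<Rightarrow> real) \<Rightarrow> (real \<Rightarrow> real) \<Rightarrow> bool" where
  "stat_converges_AE f g \<longleftrightarrow> (AE x in unit_interval. stat_converges (\<lambda>n. f n x) (g x))"

definition stat_converges_in_measure :: "(nat \<Rightarrow> real \<Rightarrow> real) \<Rightarrow> (real \<Rightarrow> real) \<Rightarrow> bool" where
  "stat_converges_in_measure f g \<longleftrightarrow>
     (\<forall>\<epsilon>>0. stat_converges (\<lambda>n. measure unit_interval {x \<in> {0..<1}. \<bar>f n x - g x\<bar> \<ge> \<epsilon>}) 0)"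

end

theory Submission
  imports Defs
begin

text \<open>
  Fix a threshold \<open>\<delta> > 0\<close> and let \<open>E\<^sub>n = {x. \<bar>f\<^sub>n x - g x\<bar> \<ge> \<delta>}\<close>. The frequency with which \<open>x\<close>
  lies in \<open>E\<^sub>1, \<dots>, E\<^sub>N\<close> is the Cesaro mean of the indicators of the \<open>E\<^sub>n\<close> at \<open>x\<close>, so its integral
  is the Cesaro mean of the measures \<open>\<lambda>(E\<^sub>n)\<close>. These measures are bounded by \<open>1\<close> and converge
  statistically to \<open>0\<close>, and for bounded sequences statistical convergence implies Cesaro
  convergence (\<open>stat_null_imp_cesaro_null\<close>). Hence the frequencies tend to \<open>0\<close> in \<open>L\<^sup>1\<close>, and so
  almost everywhere along some subsequence.

  In general one cannot say more. But if the density of \<open>{n. x \<in> E\<^sub>n}\<close> exists for almost every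
  \<open>x\<close>, then the full sequence of frequencies converges at almost every \<open>x\<close>, and its limit must
  agree with the limit \<open>0\<close> of the subsequence (\<open>AE_density_zero\<close>). The hypothesis supplies this for
  thresholds \<open>\<epsilon>\<^sub>j\<close> tending to \<open>0\<close>; as the sets \<open>E\<^sub>n\<close> shrink when \<open>\<delta>\<close> grows, it then holds for every
  positive threshold, since each lies above one of the \<open>\<epsilon>\<^sub>j\<close>. Countably many \<open>\<epsilon>\<^sub>j\<close> suffice, so one
  null set serves for all thresholds simultaneously.
\<close>

text \<open>Written as Cesaro means of indicators, frequencies can be integrated term by term.\<close>

lemma frequency_eq_cesaro_mean:
  "real (card {k \<in> A. 1 \<le> k \<and> k \<le> n}) / real n = (\<Sum>k=1..n. indicator A k) / real n"
proof -
  have "{k \<in> A. 1 \<le> k \<and> k \<le> n} = {1..n} \<inter> A"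
    by auto
  then show ?thesis
    by (simp add: indicator_def sum.If_cases)
qed

lemma has_density_iff_cesaro:
  "has_density A c \<longleftrightarrow> (\<lambda>n. (\<Sum>k=1..n. indicator A k) / real n) \<longlonglongrightarrow> c"
  unfolding has_density_def frequency_eq_cesaro_mean ..

lemma has_density_Compl:
  assumes "has_density A c"
  shows "has_density (- A) (1 - c)"
proof -
  have "(\<lambda>n. 1 - (\<Sum>k=1..n. indicator A k) / real n) \<longlonglongrightarrow> 1 - c"
    using assms unfolding has_density_iff_cesaro by (intro tendsto_intros)
  moreover have "\<forall>\<^sub>F n in sequentially. 1 - (\<Sum>k=1..n. indicator A k) / real n
      = (\<Sum>k=1..n. indicator (- A) k) / real n"
    using eventually_gt_at_top[of 0]
    by eventually_elim (simp add: indicator_compl sum_subtractf diff_divide_distrib)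
  ultimately show ?thesis
    unfolding has_density_iff_cesaro by (rule Lim_transform_eventually)
qed

lemma has_density_zero_subset:
  assumes "has_density B 0" and "A \<subseteq> B"
  shows "has_density A 0"
  unfolding has_density_iff_cesaro
proof (rule tendsto_sandwich[OF _ _ tendsto_const assms(1)[unfolded has_density_iff_cesaro]])
  show "\<forall>\<^sub>F n in sequentially. 0 \<le> (\<Sum>k=1..n. indicator A k) / real n"
    by (simp add: sum_nonneg)
  show "\<forall>\<^sub>F n in sequentially.
      (\<Sum>k=1..n. indicator A k) / real n \<le> (\<Sum>k=1..n. indicator B k) / real n"
    using assms(2) by (intro always_eventually allI divide_right_mono sum_mono)
      (auto simp: indicator_def)
qed

text \<open>
  The terms of size at least \<open>\<delta>\<close> contribute to the mean at most their frequency, which tends to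
  \<open>0\<close>; the remaining terms contribute at most \<open>\<delta>\<close>.
\<close>

lemma stat_null_imp_cesaro_null:
  fixes a :: "nat \<Rightarrow> real"
  assumes conv: "stat_converges a 0" and bounds: "\<And>n. 0 \<le> a n" "\<And>n. a n \<le> 1"
  shows "(\<lambda>n. (\<Sum>k=1..n. a k) / real n) \<longlonglongrightarrow> 0"
proof (rule LIMSEQ_I)
  fix r :: real
  assume "r > 0"
  define \<delta> where "\<delta> = r / 2"
  have "\<delta> > 0" using \<open>r > 0\<close> by (simp add: \<delta>_def)
  define L where "L = {n. \<bar>a n - 0\<bar> \<ge> \<delta>}"
  have "has_density L 0"
    using conv \<open>\<delta> > 0\<close> unfolding stat_converges_def L_def by blast
  then obtain N where N: "\<And>n. n \<ge> N \<Longrightarrow> norm ((\<Sum>k=1..n. indicator L k) / real n - 0) < \<delta>"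
    unfolding has_density_iff_cesaro using LIMSEQ_D[OF _ \<open>\<delta> > 0\<close>] by blast
  have "norm ((\<Sum>k=1..n. a k) / real n - 0) < r" if n: "n \<ge> max N 1" for n
  proof -
    have "(\<Sum>k=1..n. a k) \<le> (\<Sum>k=1..n. \<delta> + indicator L k)"
      using bounds \<open>\<delta> > 0\<close> by (intro sum_mono) (auto simp: L_def indicator_def add_increasing)
    also have "\<dots> = real n * \<delta> + (\<Sum>k=1..n. indicator L k)"
      by (simp add: sum.distrib)
    finally have "(\<Sum>k=1..n. a k) / real n \<le> \<delta> + (\<Sum>k=1..n. indicator L k) / real n"
      using n by (simp add: field_simps)
    moreover have "(\<Sum>k=1..n. indicator L k) / real n < \<delta>"
      using N[of n] n unfolding real_norm_def by linarith
    moreover have "0 \<le> (\<Sum>k=1..n. a k) / real n"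
      using bounds by (simp add: sum_nonneg)
    ultimately show ?thesis
      unfolding real_norm_def \<delta>_def by linarith
  qed
  then show "\<exists>no. \<forall>n\<ge>no. norm ((\<Sum>k=1..n. a k) / real n - 0) < r"
    by blast
qed

text \<open>
  Convergence in mean gives a subsequence that tends to \<open>0\<close> almost everywhere; where the whole
  sequence converges, the two limits coincide.
\<close>

lemma L1_null_convergent_imp_AE_null:
  fixes u :: "nat \<Rightarrow> 'a \<Rightarrow> real"
  assumes "\<And>n. integrable M (u n)"
    and "(\<lambda>n. \<integral>x. norm (u n x) \<partial>M) \<longlonglongrightarrow> 0"
    and conv: "AE x in M. convergent (\<lambda>n. u n x)"
  shows "AE x in M. (\<lambda>n. u n x) \<longlonglongrightarrow> 0"
proof -
  obtain r where r: "strict_mono r" "AE x in M. (\<lambda>n. u (r n) x) \<longlonglongrightarrow> 0"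
    using tendsto_L1_AE_subseq[OF assms(1,2)] by blast
  show ?thesis
    using r(2) conv
  proof eventually_elim
    case (elim x)
    then obtain l where l: "(\<lambda>n. u n x) \<longlonglongrightarrow> l"
      by (auto simp: convergent_def)
    then have "(\<lambda>n. u (r n) x) \<longlonglongrightarrow> l"
      using LIMSEQ_subseq_LIMSEQ[OF l r(1)] by (simp add: o_def)
    then have "l = 0"
      using elim(1) LIMSEQ_unique by blast
    with l show ?case by simp
  qed
qed

text \<open>
  By linearity the integral of the frequency is the Cesaro mean of the measures, so the frequencies
  converge to \<open>0\<close> in mean, while existence of the density is their pointwise convergence.
\<close>

lemma AE_density_zero:
  fixes E :: "nat \<Rightarrow> 'a set"
  assumes "finite_measure M"
    and meas: "\<And>n. n \<ge> 1 \<Longrightarrow> E n \<in> sets M"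
    and null: "(\<lambda>N. (\<Sum>n=1..N. measure M (E n)) / real N) \<longlonglongrightarrow> 0"
    and ex: "AE x in M. density_exists {n. x \<in> E n}"
  shows "AE x in M. has_density {n. x \<in> E n} 0"
proof -
  interpret finite_measure M by fact
  define u where "u N x = (\<Sum>n=1..N. indicator (E n) x) / real N" for N x
  have density_iff: "has_density {n. x \<in> E n} c \<longleftrightarrow> (\<lambda>N. u N x) \<longlonglongrightarrow> c" for x c
    unfolding has_density_iff_cesaro u_def by (simp add: indicator_def)
  have int_ind: "integrable M (indicator (E n) :: 'a \<Rightarrow> real)" if "n \<ge> 1" for n
    using meas[OF that] by (simp add: emeasure_eq_measure)
  have "integrable M (u N)" for N
    unfolding u_def using int_ind by (intro integrable_divide integrable_sum) auto
  moreover have "(\<integral>x. norm (u N x) \<partial>M) = (\<Sum>n=1..N. measure M (E n)) / real N" for N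
  proof -
    have "(\<integral>x. norm (u N x) \<partial>M) = (\<integral>x. (\<Sum>n=1..N. indicator (E n) x) / real N \<partial>M)"
      unfolding u_def by (simp add: sum_nonneg)
    also have "\<dots> = (\<Sum>n=1..N. \<integral>x. indicator (E n) x \<partial>M) / real N"
      using int_ind by (simp add: Bochner_Integration.integral_sum)
    also have "\<dots> = (\<Sum>n=1..N. measure M (E n)) / real N"
      using meas sets.sets_into_space
      by (intro arg_cong2[where f = "(/)"] sum.cong) (auto simp: Int_absorb2)
    finally show ?thesis .
  qed
  moreover have "AE x in M. convergent (\<lambda>N. u N x)"
    using ex unfolding density_exists_def density_iff convergent_def .
  ultimately show ?thesis
    unfolding density_iff using null by (intro L1_null_convergent_imp_AE_null) simp_all
qed

theorem theorem2p3:
  fixes f :: "nat \<Rightarrow> real \<Rightarrow> real" and g :: "real \<Rightarrow> real"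
  assumes "\<And>n. n \<ge> 1 \<Longrightarrow> f n \<in> borel_measurable unit_interval"
    and "g \<in> borel_measurable unit_interval"
    and "stat_converges_in_measure f g"
    and "\<exists>e :: nat \<Rightarrow> real. (\<forall>j\<ge>1. e j > 0) \<and> e \<longlonglongrightarrow> 0 \<and>
           (\<forall>j\<ge>1. AE x in unit_interval. density_exists {n. \<bar>f n x - g x\<bar> < e j})"
  shows "(\<forall>\<epsilon>>0. AE x in unit_interval. has_density {n. \<bar>f n x - g x\<bar> \<ge> \<epsilon>} 0) \<and>
         stat_converges_AE f g"
proof -
  obtain e :: "nat \<Rightarrow> real" where e_pos: "\<And>j. j \<ge> 1 \<Longrightarrow> e j > 0" and e_null: "e \<longlonglongrightarrow> 0"
    and e_dens: "\<And>j. j \<ge> 1 \<Longrightarrow>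
      AE x in unit_interval. density_exists {n. \<bar>f n x - g x\<bar> < e j}"
    using assms(4) by blast
  interpret finite_measure unit_interval
    by (rule finite_measureI) (simp add: emeasure_restrict_space)
  have measure_le_1: "measure unit_interval A \<le> 1" for A
    using bounded_measure[of A] by (simp add: measure_restrict_space)

  have threshold: "AE x in unit_interval. has_density {n. \<bar>f n x - g x\<bar> \<ge> e j} 0"
    if j: "j \<ge> 1" for j
  proof -
    define E where "E n = {x \<in> {0..<1}. \<bar>f n x - g x\<bar> \<ge> e j}" for n
    have E_iff: "{n. x \<in> E n} = {n. \<bar>f n x - g x\<bar> \<ge> e j}" if "x \<in> space unit_interval" for x
      using that by (simp add: E_def)
    have "E n \<in> sets unit_interval" if "n \<ge> 1" for n
    proof -
      note [measurable] = assms(1)[OF that] assms(2)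
      have "{x \<in> space unit_interval. \<bar>f n x - g x\<bar> \<ge> e j} \<in> sets unit_interval"
        by measurable
      then show ?thesis by (simp add: E_def)
    qed
    moreover have "(\<lambda>N. (\<Sum>n=1..N. measure unit_interval (E n)) / real N) \<longlonglongrightarrow> 0"
    proof (rule stat_null_imp_cesaro_null)
      show "stat_converges (\<lambda>n. measure unit_interval (E n)) 0"
        using assms(3) e_pos[OF j] unfolding stat_converges_in_measure_def E_def by blast
    qed (auto intro: measure_le_1)
    moreover have "AE x in unit_interval. density_exists {n. x \<in> E n}"
      using e_dens[OF j] AE_space
    proof eventually_elim
      case (elim x)
      have "{n. x \<in> E n} = - {n. \<bar>f n x - g x\<bar> < e j}"
        unfolding E_iff[OF elim(2)] by auto
      then show ?case
        using elim(1) has_density_Compl unfolding density_exists_def by metis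
    qed
    ultimately have "AE x in unit_interval. has_density {n. x \<in> E n} 0"
      by (intro AE_density_zero) (auto intro: finite_measure_axioms)
    then show ?thesis
      using AE_space by eventually_elim (simp add: E_iff)
  qed

  have "AE x in unit_interval. \<forall>j\<in>{1..}. has_density {n. \<bar>f n x - g x\<bar> \<ge> e j} 0"
    using threshold by (intro AE_ball_countable') auto
  then have all: "AE x in unit_interval. \<forall>\<epsilon>>0. has_density {n. \<bar>f n x - g x\<bar> \<ge> \<epsilon>} 0"
  proof eventually_elim
    case (elim x)
    show ?case
    proof (intro allI impI)
      fix \<epsilon> :: real
      assume "\<epsilon> > 0"
      then have "\<forall>\<^sub>F j in sequentially. e j < \<epsilon> \<and> j \<ge> 1"
        by (intro eventually_conj order_tendstoD(2)[OF e_null] eventually_ge_at_top)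
      then obtain j where "e j < \<epsilon>" "j \<ge> 1"
        by (auto dest: eventually_happens)
      then have "{n. \<bar>f n x - g x\<bar> \<ge> \<epsilon>} \<subseteq> {n. \<bar>f n x - g x\<bar> \<ge> e j}"
        by auto
      then show "has_density {n. \<bar>f n x - g x\<bar> \<ge> \<epsilon>} 0"
        using elim \<open>j \<ge> 1\<close> by (intro has_density_zero_subset[OF bspec[OF elim, of j]]) auto
    qed
  qed
  have "AE x in unit_interval. has_density {n. \<bar>f n x - g x\<bar> \<ge> \<epsilon>} 0" if "\<epsilon> > 0" for \<epsilon>
    using all by eventually_elim (use that in blast)
  with all show ?thesis
    unfolding stat_converges_AE_def stat_converges_def by blast
qed

end
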